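(* Let $n\ge 4$, and let $A,B$ be finite multisets of elements of $\Sigma_n$. The binomial equation $$\prod_{\sigma\in A}z_\sigma-\prod_{\tau\in B}z_\tau=0$$ holds on $T_n$ if and only if the multiset of adjacencies of all permutations in $A$ (counted with multiplicity) equals the multiset of adjacencies of all permutations in $B$. Moreover, the set of all such binomials generates the ideal $\mathcal{I}(T_n)\subseteq\mathbb{C}[z_\sigma:\sigma\in\Sigma_n]$.
   Context: $\Sigma_n$ is the set of permutations $\sigma=\sigma_1\cdots\sigma_n$ of $[n]$ with $\sigma_1=1$, $\sigma_2=2$; indices of the letters of $\sigma$ are cyclic, $\sigma_{n+1}:=\sigma_1$. The adjacencies of $\sigma$ are the $n$ unordered pairs $\{\sigma_i,\sigma_{i+1}\}$, $i=1,\dots,n$. The toric Parke--Taylor variety $T_n\subseteq\mathbb{P}^{(n-2)!-1}$ (homogeneous coordinates $z_\sigma$, $\sigma\in\Sigma_n$) is the Zariski closure of the image of the monomial map $\tilde\varphi_n:\mathbb{P}^{\binom n2-1}\dashrightarrow\mathbb{P}^{(n-2)!-1}$, $z_\sigma=\prod_{i=1}^n\frac{1}{p_{\sigma_i\sigma_{i+1}}}$, where the coordinates $p_{ij}$ on $\mathbb{P}^{\binom n2-1}$ are indexed by unordered pairs (so $p_{ij}=p_{ji}$ here). Equivalently, $T_n$ is the toric variety of the $0/1$ matrix with rows indexed by $2$-subsets $\{i,j\}\subset[n]$, columns by $\sigma\in\Sigma_n$, and entry $1$ exactly when $\{i,j\}$ is an adjacency of $\sigma$. $\mathcal{I}(T_n)$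 is its vanishing ideal. *)

theory Defs
  imports
    Complex_Main
    "HOL-Library.Multiset"
    "HOL-Library.Poly_Mapping"
    "HOL-Combinatorics.Permutations"
    "HOL-Algebra.Ideal"
begin

subsection \<open>The polynomial ring over the complex numbers in a set of variables\<close>

text \<open>A monomial is a finitely supported exponent function, and a polynomial a finitely
  supported coefficient function on monomials.\<close>

type_synonym 'v cpoly = "('v \<Rightarrow>\<^sub>0 nat) \<Rightarrow>\<^sub>0 complex"

definition poly_ring :: "'v set \<Rightarrow> 'v cpoly ring" where
  "poly_ring V =
     \<lparr>carrier = {f. \<forall>m \<in> Poly_Mapping.keys f. Poly_Mapping.keys m \<subseteq> V},
      mult = (*), one = 1, zero = 0, add = (+)\<rparr>"

definition var :: "'v \<Rightarrow> 'v cpoly" where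
  "var x = Poly_Mapping.single (Poly_Mapping.single x 1) 1"

definition cpoly_eval :: "('v \<Rightarrow> complex) \<Rightarrow> 'v cpoly \<Rightarrow> complex" where
  "cpoly_eval a f = (\<Sum>m \<in> Poly_Mapping.keys f.
     Poly_Mapping.lookup f m *
       (\<Prod>x \<in> Poly_Mapping.keys m. a x ^ Poly_Mapping.lookup m x))"

definition homogeneous :: "'v cpoly \<Rightarrow> bool" where
  "homogeneous f \<longleftrightarrow> (\<exists>d. \<forall>m \<in> Poly_Mapping.keys f.
     (\<Sum>x \<in> Poly_Mapping.keys m. Poly_Mapping.lookup m x) = d)"

lemma cring_poly_ring: "cring (poly_ring V)"
proof (rule cringI)
  show "abelian_group (poly_ring V)"
  proof (rule abelian_groupI)
    fix f g assume "f \<in> carrier (poly_ring V)" "g \<in> carrier (poly_ring V)"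
    then show "f \<oplus>\<^bsub>poly_ring V\<^esub> g \<in> carrier (poly_ring V)"
      using Poly_Mapping.keys_add[of f g] by (auto simp: poly_ring_def)
  next
    fix f assume f: "f \<in> carrier (poly_ring V)"
    then show "\<exists>g\<in>carrier (poly_ring V). g \<oplus>\<^bsub>poly_ring V\<^esub> f = \<zero>\<^bsub>poly_ring V\<^esub>"
      by (intro bexI[of _ "- f"]) (auto simp: poly_ring_def)
  qed (auto simp: poly_ring_def algebra_simps)
  show "Group.comm_monoid (poly_ring V)"
  proof (rule comm_monoidI)
    fix f g assume fg: "f \<in> carrier (poly_ring V)" "g \<in> carrier (poly_ring V)"
    show "f \<otimes>\<^bsub>poly_ring V\<^esub> g \<in> carrier (poly_ring V)"
    proof -
      have "Poly_Mapping.keys m \<subseteq> V" if m: "m \<in> Poly_Mapping.keys (f * g)" for m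
      proof -
        obtain a b where "m = a + b" "a \<in> Poly_Mapping.keys f" "b \<in> Poly_Mapping.keys g"
          using m keys_mult[of f g] by auto
        with fg show ?thesis
          using Poly_Mapping.keys_add[of a b] unfolding poly_ring_def by fastforce
      qed
      then show ?thesis by (simp add: poly_ring_def)
    qed
  qed (auto simp: poly_ring_def algebra_simps)
qed (auto simp: poly_ring_def algebra_simps)


subsection \<open>Projective space and its Zariski topology\<close>

text \<open>The projective space with homogeneous coordinates indexed by a set \<open>V\<close>. Coordinate
  vectors are functions that are zero outside \<open>V\<close>; a point is the set of all its homogeneous
  coordinate vectors.\<close>

definition nonzero_vectors :: "'v set \<Rightarrow> ('v \<Rightarrow> complex) set" where
  "nonzero_vectors V = {a. (\<forall>x. x \<notin> V \<longrightarrow> a x = 0) \<and> (\<exists>x\<in>V. a x \<noteq> 0)}"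

definition scaling_rel :: "'v set \<Rightarrow> (('v \<Rightarrow> complex) \<times> ('v \<Rightarrow> complex)) set" where
  "scaling_rel V = {(a, b). a \<in> nonzero_vectors V \<and> b \<in> nonzero_vectors V \<and>
     (\<exists>c. c \<noteq> 0 \<and> b = (\<lambda>x. c * a x))}"

definition proj_space :: "'v set \<Rightarrow> ('v \<Rightarrow> complex) set set" where
  "proj_space V = nonzero_vectors V // scaling_rel V"

definition proj_point :: "'v set \<Rightarrow> ('v \<Rightarrow> complex) \<Rightarrow> ('v \<Rightarrow> complex) set" where
  "proj_point V a = scaling_rel V `` {a}"

lemma equiv_scaling_rel: "equiv (nonzero_vectors V) (scaling_rel V)"
proof (rule equivI)
  show "scaling_rel V \<subseteq> nonzero_vectors V \<times> nonzero_vectors V"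
    by (auto simp: scaling_rel_def)
  show "refl_on (nonzero_vectors V) (scaling_rel V)"
    by (auto simp: refl_on_def scaling_rel_def intro: exI[of _ 1])
  show "sym (scaling_rel V)"
  proof (rule symI)
    fix a b assume "(a, b) \<in> scaling_rel V"
    then obtain c where "c \<noteq> 0" "b = (\<lambda>x. c * a x)"
      and "a \<in> nonzero_vectors V" "b \<in> nonzero_vectors V"
      by (auto simp: scaling_rel_def)
    then show "(b, a) \<in> scaling_rel V"
      by (auto simp: scaling_rel_def intro!: exI[of _ "1 / c"])
  qed
  show "trans (scaling_rel V)"
  proof (rule transI)
    fix a b d assume ab: "(a, b) \<in> scaling_rel V" and bd: "(b, d) \<in> scaling_rel V"
    obtain c where c: "c \<noteq> 0" "b = (\<lambda>x. c * a x)" using ab by (auto simp: scaling_rel_def)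
    obtain c' where c': "c' \<noteq> 0" "d = (\<lambda>x. c' * b x)" using bd by (auto simp: scaling_rel_def)
    have "c' * c \<noteq> 0" "d = (\<lambda>x. (c' * c) * a x)" using c c' by (auto simp: mult.assoc)
    with ab bd show "(a, d) \<in> scaling_rel V"
      unfolding scaling_rel_def by blast
  qed
qed

text \<open>A polynomial, homogeneous or not, vanishes on a set of points if it is zero at all
  homogeneous coordinate vectors of all these points.\<close>

definition vanishes_on :: "'v cpoly \<Rightarrow> ('v \<Rightarrow> complex) set set \<Rightarrow> bool" where
  "vanishes_on f X \<longleftrightarrow> (\<forall>P\<in>X. \<forall>a\<in>P. cpoly_eval a f = 0)"

definition zariski_closed :: "'v set \<Rightarrow> ('v \<Rightarrow> complex) set set \<Rightarrow> bool" where
  "zariski_closed V Z \<longleftrightarrow>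
     (\<exists>S. S \<subseteq> {f \<in> carrier (poly_ring V). homogeneous f} \<and>
          Z = {P \<in> proj_space V. \<forall>f\<in>S. vanishes_on f {P}})"

definition zariski_closure :: "'v set \<Rightarrow> ('v \<Rightarrow> complex) set set \<Rightarrow> ('v \<Rightarrow> complex) set set" where
  "zariski_closure V X = \<Inter>{Z. zariski_closed V Z \<and> X \<subseteq> Z}"

definition vanishing_ideal :: "'v set \<Rightarrow> ('v \<Rightarrow> complex) set set \<Rightarrow> 'v cpoly set" where
  "vanishing_ideal V X = {f \<in> carrier (poly_ring V). vanishes_on f X}"


subsection \<open>The toric Parke--Taylor variety\<close>

definition PT_perms :: "nat \<Rightarrow> (nat \<Rightarrow> nat) set" where
  "PT_perms n = {\<sigma>. \<sigma> permutes {1..n} \<and> \<sigma> 1 = 1 \<and> \<sigma> 2 = 2}"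

text \<open>For \<open>1 \<le> i \<le> n\<close>, the cyclic successor of the index \<open>i\<close> is \<open>i mod n + 1\<close>.\<close>

definition adjacencies :: "nat \<Rightarrow> (nat \<Rightarrow> nat) \<Rightarrow> nat set multiset" where
  "adjacencies n \<sigma> = {# {\<sigma> i, \<sigma> (i mod n + 1)}. i \<in># mset_set {1..n} #}"

definition pairs :: "nat \<Rightarrow> nat set set" where
  "pairs n = {e. e \<subseteq> {1..n} \<and> card e = 2}"

definition PT_map :: "nat \<Rightarrow> (nat set \<Rightarrow> complex) \<Rightarrow> (nat \<Rightarrow> nat) \<Rightarrow> complex" where
  "PT_map n p = (\<lambda>\<sigma>. if \<sigma> \<in> PT_perms n
     then \<Prod>i = 1..n. 1 / p {\<sigma> i, \<sigma> (i mod n + 1)} else 0)"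

text \<open>The image of the rational map is taken over the points none of whose coordinates vanish,
  where its defining formula makes sense.\<close>

definition PT_image :: "nat \<Rightarrow> ((nat \<Rightarrow> nat) \<Rightarrow> complex) set set" where
  "PT_image n = {proj_point (PT_perms n) (PT_map n p) | P p.
     P \<in> proj_space (pairs n) \<and> p \<in> P \<and> (\<forall>e\<in>pairs n. p e \<noteq> 0)}"

definition toric_PT_variety :: "nat \<Rightarrow> ((nat \<Rightarrow> nat) \<Rightarrow> complex) set set" where
  "toric_PT_variety n = zariski_closure (PT_perms n) (PT_image n)"

definition binomial_poly ::
    "(nat \<Rightarrow> nat) multiset \<Rightarrow> (nat \<Rightarrow> nat) multiset \<Rightarrow> (nat \<Rightarrow> nat) cpoly" where
  "binomial_poly A B = (\<Prod>\<sigma>\<in>#A. var \<sigma>) - (\<Prod>\<tau>\<in>#B. var \<tau>)"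

end

theory Submission
  imports
    Defs
    "HOL-Computational_Algebra.Primes"
    "HOL-Computational_Algebra.Polynomial"
begin

text \<open>
  In the inverse coordinates \<open>q e = 1 / p e\<close> the monomial map sends \<open>z\<^sub>\<sigma>\<close> to the product of \<open>q e\<close>
  over the adjacencies \<open>e\<close> of \<open>\<sigma>\<close>. Hence the monomial of a multiset \<open>A\<close> of permutations pulls
  back to the monomial in \<open>q\<close> whose exponents are the multiplicities in the adjacency multiset
  of \<open>A\<close> (\<open>prod_PT_map\<close>).

  If \<open>A\<close> and \<open>B\<close> have the same adjacency multiset, their binomial therefore vanishes on the image
  of the map. Every permutation has \<open>n\<close> adjacencies, so \<open>A\<close> and \<open>B\<close> have the same size and the
  binomial is homogeneous; hence it also vanishes on the Zariski closure
  (\<open>binomial_vanishes_on_variety\<close>).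

  For the converse and for the statement on generators, it suffices to look at special points
  of the image: choose distinct primes \<open>\<pi> e\<close> for the pairs \<open>e\<close> and take \<open>q e = (\<pi> e)\<^sup>k\<close>. A monomial
  with adjacency multiset \<open>\<alpha>\<close> takes the value \<open>v(\<alpha>)\<^sup>k\<close> there, where \<open>v(\<alpha>)\<close> is the product of the
  primes \<open>\<pi> e\<close> for \<open>e\<close> in \<open>\<alpha>\<close>, and by unique factorization the numbers \<open>v(\<alpha>)\<close> are distinct. With
  \<open>k = 1\<close> this shows that a vanishing binomial has equal adjacency multisets. Letting \<open>k\<close> vary,
  the linear independence of the sequences \<open>k \<mapsto> v\<^sup>k\<close> for distinct \<open>v\<close> (\<open>geometric_sum_zero\<close>) shows
  that in a polynomial \<open>f\<close> that vanishes on the image, the coefficients of the monomials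
  with any fixed adjacency multiset sum to zero (\<open>adjacency_class_coeffs_sum_zero\<close>). Replacing
  each monomial of \<open>f\<close> by a fixed representative of its adjacency class thus turns \<open>f\<close> into \<open>0\<close>,
  and each single replacement changes \<open>f\<close> by a constant multiple of one of the binomials.
\<close>

section \<open>Monomials and evaluation of polynomials\<close>

text \<open>The multiset in which every variable occurs as often as its exponent in the monomial.\<close>

definition exp_mset :: "('v \<Rightarrow>\<^sub>0 nat) \<Rightarrow> 'v multiset" where
  "exp_mset m = Abs_multiset (Poly_Mapping.lookup m)"

text \<open>The exponent function with the multiplicities of a multiset; inverse to \<^const>\<open>exp_mset\<close>.\<close>

definition mset_exp :: "'v multiset \<Rightarrow> ('v \<Rightarrow>\<^sub>0 nat)" where
  "mset_exp A = (\<Sum>x\<in>#A. Poly_Mapping.single x 1)"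

lemma count_exp_mset [simp]: "count (exp_mset m) = Poly_Mapping.lookup m"
proof -
  have "{x. Poly_Mapping.lookup m x > 0} = Poly_Mapping.keys m"
    by (auto simp: in_keys_iff)
  then show ?thesis unfolding exp_mset_def by (intro count_Abs_multiset) simp
qed

lemma lookup_mset_exp [simp]: "Poly_Mapping.lookup (mset_exp A) = count A"
  by (rule ext, induction A) (auto simp: mset_exp_def lookup_add lookup_single)

lemma exp_mset_mset_exp [simp]: "exp_mset (mset_exp A) = A"
  by (rule multiset_eqI) simp

lemma mset_exp_exp_mset [simp]: "mset_exp (exp_mset m) = m"
  by (rule poly_mapping_eqI) simp

lemma exp_mset_add: "exp_mset (m + m') = exp_mset m + exp_mset m'"
  by (rule multiset_eqI) (simp add: lookup_add)

lemma set_exp_mset [simp]: "set_mset (exp_mset m) = Poly_Mapping.keys m"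
  by (auto simp: set_mset_def in_keys_iff)

lemma prod_mset_var: "(\<Prod>x\<in>#A. var x) = Poly_Mapping.single (mset_exp A) 1"
  by (induction A) (auto simp: mset_exp_def var_def mult_single)

lemma sum_lookup_exp: "(\<Sum>x\<in>Poly_Mapping.keys m. Poly_Mapping.lookup m x) = size (exp_mset m)"
  by (simp add: size_multiset_overloaded_eq)

lemma cpoly_eval_alt:
  assumes "finite M" "Poly_Mapping.keys f \<subseteq> M"
  shows "cpoly_eval a f = (\<Sum>m\<in>M. Poly_Mapping.lookup f m * (\<Prod>x\<in>#exp_mset m. a x))"
proof -
  have "cpoly_eval a f =
      (\<Sum>m\<in>Poly_Mapping.keys f. Poly_Mapping.lookup f m * (\<Prod>x\<in>#exp_mset m. a x))"
    unfolding cpoly_eval_def by (simp add: image_prod_mset_multiplicity)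
  also have "\<dots> = (\<Sum>m\<in>M. Poly_Mapping.lookup f m * (\<Prod>x\<in>#exp_mset m. a x))"
    using assms by (intro sum.mono_neutral_left) (auto simp: in_keys_iff)
  finally show ?thesis .
qed

lemma cpoly_eval_add: "cpoly_eval a (f + g) = cpoly_eval a f + cpoly_eval a g"
proof -
  let ?M = "Poly_Mapping.keys f \<union> Poly_Mapping.keys g"
  have "Poly_Mapping.keys (f + g) \<subseteq> ?M" by (rule Poly_Mapping.keys_add)
  then show ?thesis
    by (simp add: cpoly_eval_alt[of ?M] lookup_add sum.distrib algebra_simps)
qed

lemma cpoly_eval_zero [simp]: "cpoly_eval a 0 = 0"
  by (simp add: cpoly_eval_def)

lemma cpoly_eval_uminus: "cpoly_eval a (- f) = - cpoly_eval a f"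
  using cpoly_eval_add[of a f "- f"] by (simp add: add_eq_0_iff)

lemma cpoly_eval_diff: "cpoly_eval a (f - g) = cpoly_eval a f - cpoly_eval a g"
  using cpoly_eval_add[of a f "- g"] by (simp add: cpoly_eval_uminus)

lemma cpoly_eval_sum: "cpoly_eval a (\<Sum>i\<in>I. f i) = (\<Sum>i\<in>I. cpoly_eval a (f i))"
  by (induction I rule: infinite_finite_induct) (auto simp: cpoly_eval_add)

lemma cpoly_eval_single: "cpoly_eval a (Poly_Mapping.single m c) = c * (\<Prod>x\<in>#exp_mset m. a x)"
  by (subst cpoly_eval_alt[of "{m}"]) auto

lemma sum_single_keys:
  "(\<Sum>m\<in>Poly_Mapping.keys f. Poly_Mapping.single m (Poly_Mapping.lookup f m)) = f"
  by (rule poly_mapping_eqI)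
    (auto simp: lookup_sum lookup_single when_def in_keys_iff sum.delta')

lemma single_sum: "Poly_Mapping.single k (sum g M) = (\<Sum>m\<in>M. Poly_Mapping.single k (g m))"
  by (induction M rule: infinite_finite_induct) (auto simp: single_add)

lemma cpoly_eval_mult: "cpoly_eval a (f * g) = cpoly_eval a f * cpoly_eval a g"
proof -
  let ?s = "\<lambda>f m. Poly_Mapping.single m (Poly_Mapping.lookup f m)"
  have "f * g = (\<Sum>m\<in>Poly_Mapping.keys f. ?s f m) * (\<Sum>m'\<in>Poly_Mapping.keys g. ?s g m')"
    by (simp only: sum_single_keys)
  also have "cpoly_eval a \<dots> = (\<Sum>m\<in>Poly_Mapping.keys f. \<Sum>m'\<in>Poly_Mapping.keys g.
      cpoly_eval a (?s f m) * cpoly_eval a (?s g m'))"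
    by (simp add: sum_product cpoly_eval_sum mult_single cpoly_eval_single exp_mset_add
        algebra_simps)
  also have "\<dots> = cpoly_eval a (\<Sum>m\<in>Poly_Mapping.keys f. ?s f m)
      * cpoly_eval a (\<Sum>m'\<in>Poly_Mapping.keys g. ?s g m')"
    by (simp add: sum_product cpoly_eval_sum)
  finally show ?thesis by (simp only: sum_single_keys)
qed


section \<open>Vanishing ideals and binomials\<close>

lemma poly_ring_simps [simp]:
  "mult (poly_ring V) = (*)" "add (poly_ring V) = (+)"
  "one (poly_ring V) = 1" "zero (poly_ring V) = 0"
  by (simp_all add: poly_ring_def)

lemma mem_poly_ring_iff:
  "f \<in> carrier (poly_ring V) \<longleftrightarrow> (\<forall>m\<in>Poly_Mapping.keys f. Poly_Mapping.keys m \<subseteq> V)"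
  by (simp add: poly_ring_def)

lemma ideal_vanishing_ideal: "ideal (vanishing_ideal V X) (poly_ring V)"
proof -
  interpret R: cring "poly_ring V" by (rule cring_poly_ring)
  show ?thesis
  proof (rule idealI)
    show "subgroup (vanishing_ideal V X) (add_monoid (poly_ring V))"
    proof (rule R.add.subgroupI)
      show "vanishing_ideal V X \<noteq> {}"
        using R.zero_closed by (auto simp: vanishing_ideal_def vanishes_on_def)
      fix f assume f: "f \<in> vanishing_ideal V X"
      have "\<ominus>\<^bsub>poly_ring V\<^esub> f = - f"
        using f by (intro R.minus_equality) (auto simp: vanishing_ideal_def mem_poly_ring_iff)
      moreover have "- f \<in> vanishing_ideal V X"
        using f by (auto simp: vanishing_ideal_def mem_poly_ring_iff vanishes_on_def
            cpoly_eval_uminus)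
      ultimately show "\<ominus>\<^bsub>poly_ring V\<^esub> f \<in> vanishing_ideal V X" by simp
    next
      fix f g assume "f \<in> vanishing_ideal V X" "g \<in> vanishing_ideal V X"
      then show "f \<oplus>\<^bsub>poly_ring V\<^esub> g \<in> vanishing_ideal V X"
        using R.a_closed[of f g] by (auto simp: vanishing_ideal_def vanishes_on_def cpoly_eval_add)
    qed (auto simp: vanishing_ideal_def)
    fix f g assume "f \<in> vanishing_ideal V X" "g \<in> carrier (poly_ring V)"
    then show "g \<otimes>\<^bsub>poly_ring V\<^esub> f \<in> vanishing_ideal V X"
      "f \<otimes>\<^bsub>poly_ring V\<^esub> g \<in> vanishing_ideal V X"
      using R.m_closed[of f g] R.m_closed[of g f]
      by (auto simp: vanishing_ideal_def vanishes_on_def cpoly_eval_mult)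
  qed (rule R.ring_axioms)
qed

lemma ideal_sum_closed:
  assumes "ideal I (poly_ring V)" "\<And>i. i \<in> S \<Longrightarrow> f i \<in> I"
  shows "(\<Sum>i\<in>S. f i) \<in> I"
proof -
  interpret I: additive_subgroup I "poly_ring V"
    using assms(1) by (rule ideal.axioms(1))
  have "0 \<in> I" "\<And>f g. f \<in> I \<Longrightarrow> g \<in> I \<Longrightarrow> f + g \<in> I"
    using I.zero_closed I.a_closed by simp_all
  then show ?thesis
    using assms(2) by (induction S rule: infinite_finite_induct) auto
qed

lemma binomial_poly_alt:
  "binomial_poly A B = Poly_Mapping.single (mset_exp A) 1 - Poly_Mapping.single (mset_exp B) 1"
  by (simp add: binomial_poly_def prod_mset_var)

lemma keys_binomial_poly: "Poly_Mapping.keys (binomial_poly A B) \<subseteq> {mset_exp A, mset_exp B}"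
  unfolding binomial_poly_alt
  by (auto simp: in_keys_iff lookup_minus lookup_single when_def split: if_splits)

lemma cpoly_eval_binomial_poly:
  "cpoly_eval a (binomial_poly A B) = (\<Prod>\<sigma>\<in>#A. a \<sigma>) - (\<Prod>\<tau>\<in>#B. a \<tau>)"
  by (simp add: binomial_poly_alt cpoly_eval_diff cpoly_eval_single)

lemma binomial_poly_carrier:
  assumes "set_mset A \<subseteq> V" "set_mset B \<subseteq> V"
  shows "binomial_poly A B \<in> carrier (poly_ring V)"
proof -
  have "Poly_Mapping.keys (mset_exp C) = set_mset C" for C :: "(nat \<Rightarrow> nat) multiset"
    using set_exp_mset[of "mset_exp C"] by simp
  then have "Poly_Mapping.keys m \<subseteq> V" if "m \<in> {mset_exp A, mset_exp B}" for m
    using assms that by auto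
  then show ?thesis
    using keys_binomial_poly[of A B] unfolding mem_poly_ring_iff by blast
qed

lemma homogeneous_binomial_poly:
  assumes "size A = size B"
  shows "homogeneous (binomial_poly A B)"
  unfolding homogeneous_def
  using keys_binomial_poly[of A B] assms
  by (intro exI[of _ "size B"]) (auto simp: sum_lookup_exp)


section \<open>The monomial map and its image\<close>

lemma pair_of_adjacent_letters:
  assumes "n \<ge> 2" "\<sigma> \<in> PT_perms n" "i \<in> {1..n}"
  shows "{\<sigma> i, \<sigma> (i mod n + 1)} \<in> pairs n"
proof -
  have \<sigma>: "\<sigma> permutes {1..n}" using assms by (simp add: PT_perms_def)
  have "i mod n < n" using assms by (intro mod_less_divisor) auto
  then have j: "i mod n + 1 \<in> {1..n}" by auto
  have "i mod n + 1 \<noteq> i"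
    using assms by (cases "i = n") auto
  then have "\<sigma> i \<noteq> \<sigma> (i mod n + 1)"
    using inj_eq[OF permutes_inj[OF \<sigma>]] by metis
  moreover have "\<sigma> i \<in> {1..n}" "\<sigma> (i mod n + 1) \<in> {1..n}"
    using permutes_in_image[OF \<sigma>] assms(3) j by blast+
  ultimately show ?thesis by (simp add: pairs_def)
qed

lemma set_adjacencies:
  assumes "n \<ge> 2" "set_mset A \<subseteq> PT_perms n"
  shows "set_mset (\<Sum>\<sigma>\<in>#A. adjacencies n \<sigma>) \<subseteq> pairs n"
proof -
  have "set_mset (adjacencies n \<sigma>) \<subseteq> pairs n" if "\<sigma> \<in> PT_perms n" for \<sigma>
    using pair_of_adjacent_letters[OF assms(1) that] by (auto simp: adjacencies_def)
  then show ?thesis using assms(2) by (induction A) auto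
qed

lemma size_adjacencies: "size (\<Sum>\<sigma>\<in>#A. adjacencies n \<sigma>) = n * size A"
  by (induction A) (auto simp: adjacencies_def)

lemma prod_PT_map:
  assumes "set_mset A \<subseteq> PT_perms n"
  shows "(\<Prod>\<sigma>\<in>#A. PT_map n p \<sigma>) = (\<Prod>e\<in>#(\<Sum>\<sigma>\<in>#A. adjacencies n \<sigma>). 1 / p e)"
proof -
  have "PT_map n p \<sigma> = (\<Prod>e\<in>#adjacencies n \<sigma>. 1 / p e)" if "\<sigma> \<in> PT_perms n" for \<sigma>
    using that
    by (simp add: PT_map_def adjacencies_def prod_unfold_prod_mset multiset.map_comp o_def)
  with assms show ?thesis by (induction A) simp_all
qed

lemma PT_map_nonzero_vector:
  assumes "n \<ge> 2" "\<And>e. e \<in> pairs n \<Longrightarrow> p e \<noteq> 0"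
  shows "PT_map n p \<in> nonzero_vectors (PT_perms n)"
proof -
  have id: "id \<in> PT_perms n" by (simp add: PT_perms_def permutes_id)
  have "PT_map n p id \<noteq> 0"
    using pair_of_adjacent_letters[OF assms(1) id] assms(2) id by (auto simp: PT_map_def)
  moreover have "PT_map n p \<sigma> = 0" if "\<sigma> \<notin> PT_perms n" for \<sigma>
    using that by (simp add: PT_map_def)
  ultimately show ?thesis using id unfolding nonzero_vectors_def by blast
qed

lemma PT_image_subset_proj_space:
  assumes "n \<ge> 2"
  shows "PT_image n \<subseteq> proj_space (PT_perms n)"
  using PT_map_nonzero_vector[OF assms]
  by (auto simp: PT_image_def proj_space_def proj_point_def intro!: quotientI)

text \<open>Any nowhere vanishing values of the inverse coordinates give a point of the image. Points of
  projective space require \<open>p\<close> to be zero outside the pairs.\<close>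

lemma eval_zero_at_inverse_coordinates:
  assumes n: "n \<ge> 2" and f: "vanishes_on f (PT_image n)" and q: "\<And>e. e \<in> pairs n \<Longrightarrow> q e \<noteq> 0"
  shows "cpoly_eval (PT_map n (\<lambda>e. if e \<in> pairs n then 1 / q e else 0)) f = 0"
proof -
  let ?p = "\<lambda>e. if e \<in> pairs n then 1 / q e else 0"
  have "{1, 2} \<in> pairs n" using n by (auto simp: pairs_def)
  then have p: "?p \<in> nonzero_vectors (pairs n)"
    using q unfolding nonzero_vectors_def by (auto intro!: bexI[of _ "{1, 2}"])
  have "proj_point (pairs n) ?p \<in> proj_space (pairs n)" "?p \<in> proj_point (pairs n) ?p"
    using p equiv_class_self[OF equiv_scaling_rel p]
    by (auto simp: proj_space_def proj_point_def intro: quotientI)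
  moreover have "\<forall>e\<in>pairs n. ?p e \<noteq> 0" using q by auto
  ultimately have "proj_point (PT_perms n) (PT_map n ?p) \<in> PT_image n"
    unfolding PT_image_def by blast
  moreover have "PT_map n ?p \<in> proj_point (PT_perms n) (PT_map n ?p)"
    unfolding proj_point_def using q
    by (intro equiv_class_self[OF equiv_scaling_rel] PT_map_nonzero_vector n) auto
  ultimately show ?thesis using f unfolding vanishes_on_def by blast
qed

lemma PT_image_subset_variety: "PT_image n \<subseteq> toric_PT_variety n"
  by (auto simp: toric_PT_variety_def zariski_closure_def)

lemma vanishes_on_variety_homogeneous:
  assumes "n \<ge> 2" "f \<in> carrier (poly_ring (PT_perms n))" "homogeneous f"
    and "vanishes_on f (PT_image n)"
  shows "vanishes_on f (toric_PT_variety n)"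
proof -
  let ?Z = "{P \<in> proj_space (PT_perms n). \<forall>g\<in>{f}. vanishes_on g {P}}"
  have "zariski_closed (PT_perms n) ?Z"
    unfolding zariski_closed_def using assms(2,3) by (intro exI[of _ "{f}"]) auto
  moreover have "PT_image n \<subseteq> ?Z"
    using PT_image_subset_proj_space[OF assms(1)] assms(4) by (auto simp: vanishes_on_def)
  ultimately have "toric_PT_variety n \<subseteq> ?Z"
    unfolding toric_PT_variety_def zariski_closure_def by blast
  then show ?thesis by (auto simp: vanishes_on_def)
qed

lemma binomial_vanishes_on_variety:
  assumes n: "n \<ge> 2" and A: "set_mset A \<subseteq> PT_perms n" and B: "set_mset B \<subseteq> PT_perms n"
    and adj: "(\<Sum>\<sigma>\<in>#A. adjacencies n \<sigma>) = (\<Sum>\<tau>\<in>#B. adjacencies n \<tau>)"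
  shows "vanishes_on (binomial_poly A B) (toric_PT_variety n)"
proof (rule vanishes_on_variety_homogeneous)
  have "n * size A = n * size B"
    using arg_cong[OF adj, of size] by (simp only: size_adjacencies)
  then have size: "size A = size B" using n by simp
  then show "homogeneous (binomial_poly A B)" by (rule homogeneous_binomial_poly)
  show "binomial_poly A B \<in> carrier (poly_ring (PT_perms n))"
    using A B by (rule binomial_poly_carrier)
  show "vanishes_on (binomial_poly A B) (PT_image n)"
    unfolding vanishes_on_def
  proof (intro ballI)
    fix P a assume "P \<in> PT_image n" "a \<in> P"
    then obtain p c where a: "a = (\<lambda>\<sigma>. c * PT_map n p \<sigma>)"
      by (auto simp: PT_image_def proj_point_def scaling_rel_def)
    have scale: "(\<Prod>\<sigma>\<in>#C. a \<sigma>) = c ^ size C * (\<Prod>\<sigma>\<in>#C. PT_map n p \<sigma>)" for C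
      by (simp add: a prod_mset.distrib)
    have "(\<Prod>\<sigma>\<in>#A. PT_map n p \<sigma>) = (\<Prod>\<tau>\<in>#B. PT_map n p \<tau>)"
      by (simp only: prod_PT_map[OF A] prod_PT_map[OF B] adj)
    then show "cpoly_eval a (binomial_poly A B) = 0"
      unfolding cpoly_eval_binomial_poly scale size by simp
  qed
qed (rule n)


section \<open>Separating adjacency multisets by prime values\<close>

lemma prime_labelling:
  assumes "finite E"
  obtains \<pi> :: "'a \<Rightarrow> nat" where "inj_on \<pi> E" "\<And>e. e \<in> E \<Longrightarrow> prime (\<pi> e)"
proof -
  obtain h :: "'a \<Rightarrow> nat" where h: "inj_on h E"
    using finite_imp_inj_to_nat_seg[OF assms] by blast
  obtain g :: "nat \<Rightarrow> nat" where g: "inj g" "range g \<subseteq> {p. prime p}"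
    using infinite_countable_subset[OF primes_infinite] by blast
  show thesis
  proof (rule that[of "g \<circ> h"])
    show "inj_on (g \<circ> h) E" using h g(1) by (auto intro: comp_inj_on inj_on_subset)
  qed (use g in auto)
qed

lemma prod_prime_labels_inj:
  fixes \<pi> :: "'a \<Rightarrow> nat"
  assumes "inj_on \<pi> E" "\<And>e. e \<in> E \<Longrightarrow> prime (\<pi> e)"
    and "set_mset A \<subseteq> E" "set_mset B \<subseteq> E" "(\<Prod>e\<in>#A. \<pi> e) = (\<Prod>e\<in>#B. \<pi> e)"
  shows "A = B"
proof -
  have "prime_factorization (\<Prod>e\<in>#C. \<pi> e) = image_mset \<pi> C" if "set_mset C \<subseteq> E" for C
    using assms(2) that by (intro prime_factorization_prod_mset_primes) auto
  then have eq: "image_mset \<pi> A = image_mset \<pi> B" using assms by metis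
  have "image_mset (inv_into E \<pi>) (image_mset \<pi> C) = C" if "set_mset C \<subseteq> E" for C
  proof -
    have "image_mset (\<lambda>e. inv_into E \<pi> (\<pi> e)) C = image_mset (\<lambda>e. e) C"
      using assms(1) that by (intro image_mset_cong) auto
    then show ?thesis by (simp add: multiset.map_comp o_def)
  qed
  then show ?thesis using eq assms(3,4) by metis
qed

text \<open>The linear independence of the sequences \<open>k \<mapsto> x\<^sup>k\<close> for distinct \<open>x\<close>, stated for a family
  of possibly repeated bases.\<close>

lemma geometric_sum_zero:
  fixes c x :: "'i \<Rightarrow> complex"
  assumes "finite I" "\<And>k. (\<Sum>i\<in>I. c i * x i ^ k) = 0"
  shows "(\<Sum>i | i \<in> I \<and> x i = y. c i) = 0"
proof -
  have zero: "(\<Sum>i\<in>I. c i * poly P (x i)) = 0" for P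
  proof -
    have "(\<Sum>i\<in>I. c i * poly P (x i)) = (\<Sum>k\<le>degree P. coeff P k * (\<Sum>i\<in>I. c i * x i ^ k))"
      by (simp add: poly_altdef sum_distrib_left mult_ac sum.swap[of _ I])
    then show ?thesis by (simp add: assms(2))
  qed
  \<comment> \<open>This polynomial vanishes at all bases except \<open>y\<close>.\<close>
  define P where "P = (\<Prod>z\<in>x ` I - {y}. [:- z, 1:])"
  have "(\<Sum>i\<in>I. c i * poly P (x i)) = (\<Sum>i | i \<in> I \<and> x i = y. c i * poly P (x i))"
    using assms(1) by (intro sum.mono_neutral_right) (auto simp: P_def poly_prod)
  also have "\<dots> = (\<Sum>i | i \<in> I \<and> x i = y. c i) * poly P y"
    by (simp add: sum_distrib_right)
  finally have "(\<Sum>i | i \<in> I \<and> x i = y. c i) * poly P y = 0" using zero by simp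
  moreover have "poly P y \<noteq> 0"
    using assms(1) by (auto simp: P_def poly_prod)
  ultimately show ?thesis by simp
qed

lemma finite_pairs: "finite (pairs n)"
  by (rule finite_subset[of _ "Pow {1..n}"]) (auto simp: pairs_def)

lemma prod_PT_map_power:
  assumes "n \<ge> 2" "set_mset A \<subseteq> PT_perms n"
  shows "(\<Prod>\<sigma>\<in>#A. PT_map n (\<lambda>e. if e \<in> pairs n then 1 / of_nat (\<pi> e) ^ k else 0) \<sigma>)
    = of_nat (\<Prod>e\<in>#(\<Sum>\<sigma>\<in>#A. adjacencies n \<sigma>). \<pi> e) ^ k"
proof -
  let ?p = "\<lambda>e. if e \<in> pairs n then 1 / of_nat (\<pi> e) ^ k else (0::complex)"
  have "(\<Prod>e\<in>#\<alpha>. 1 / ?p e) = of_nat (\<Prod>e\<in>#\<alpha>. \<pi> e) ^ k" if "set_mset \<alpha> \<subseteq> pairs n" for \<alpha>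
    using that by (induction \<alpha>) (auto simp: power_mult_distrib)
  then show ?thesis
    using prod_PT_map[OF assms(2), of ?p] set_adjacencies[OF assms] by simp
qed

text \<open>This says that the pullback of \<open>f\<close> to the inverse coordinates is the zero polynomial.\<close>

lemma adjacency_class_coeffs_sum_zero:
  assumes n: "n \<ge> 2" and f: "f \<in> carrier (poly_ring (PT_perms n))"
    and van: "vanishes_on f (PT_image n)"
  shows "(\<Sum>m | m \<in> Poly_Mapping.keys f \<and> (\<Sum>\<sigma>\<in>#exp_mset m. adjacencies n \<sigma>) = \<alpha>.
    Poly_Mapping.lookup f m) = 0"
proof (cases "set_mset \<alpha> \<subseteq> pairs n")
  case True
  let ?d = "\<lambda>m. \<Sum>\<sigma>\<in>#exp_mset m. adjacencies n \<sigma>"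
  obtain \<pi> :: "nat set \<Rightarrow> nat"
    where \<pi>: "inj_on \<pi> (pairs n)" "\<And>e. e \<in> pairs n \<Longrightarrow> prime (\<pi> e)"
    using prime_labelling[OF finite_pairs] by blast
  let ?v = "\<lambda>\<beta>. \<Prod>e\<in>#\<beta>. \<pi> e"
  have sub: "set_mset (exp_mset m) \<subseteq> PT_perms n" if "m \<in> Poly_Mapping.keys f" for m
    using f that by (auto simp: mem_poly_ring_iff)
  have "(\<Sum>m\<in>Poly_Mapping.keys f. Poly_Mapping.lookup f m * of_nat (?v (?d m)) ^ k) = 0" for k
  proof -
    let ?p = "\<lambda>e. if e \<in> pairs n then 1 / of_nat (\<pi> e) ^ k else (0::complex)"
    have "(\<Sum>m\<in>Poly_Mapping.keys f. Poly_Mapping.lookup f m * of_nat (?v (?d m)) ^ k)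
      = cpoly_eval (PT_map n ?p) f"
      by (subst cpoly_eval_alt[of "Poly_Mapping.keys f"])
        (auto intro!: sum.cong simp: prod_PT_map_power[OF n sub])
    also have "\<dots> = 0"
      using \<pi>(2) by (intro eval_zero_at_inverse_coordinates n van) (auto dest: prime_gt_0_nat)
    finally show ?thesis .
  qed
  from geometric_sum_zero[OF finite_keys this, of "of_nat (?v \<alpha>)"]
  have "(\<Sum>m | m \<in> Poly_Mapping.keys f \<and> ?v (?d m) = ?v \<alpha>. Poly_Mapping.lookup f m) = 0"
    by (simp only: of_nat_eq_iff)
  moreover have "?v (?d m) = ?v \<alpha> \<longleftrightarrow> ?d m = \<alpha>" if "m \<in> Poly_Mapping.keys f" for m
    using prod_prime_labels_inj[OF \<pi> set_adjacencies[OF n sub[OF that]] True] by auto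
  ultimately show ?thesis by (simp cong: conj_cong)
next
  case False
  have "(\<Sum>\<sigma>\<in>#exp_mset m. adjacencies n \<sigma>) \<noteq> \<alpha>" if "m \<in> Poly_Mapping.keys f" for m
  proof -
    have "set_mset (exp_mset m) \<subseteq> PT_perms n"
      using f that by (simp add: mem_poly_ring_iff)
    then show ?thesis using set_adjacencies[OF n] False by metis
  qed
  then have "{m \<in> Poly_Mapping.keys f. (\<Sum>\<sigma>\<in>#exp_mset m. adjacencies n \<sigma>) = \<alpha>} = {}"
    by blast
  then show ?thesis by (simp only: sum.empty)
qed

lemma adjacencies_eq_if_binomial_vanishes:
  assumes n: "n \<ge> 2" and A: "set_mset A \<subseteq> PT_perms n" and B: "set_mset B \<subseteq> PT_perms n"
    and van: "vanishes_on (binomial_poly A B) (PT_image n)"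
  shows "(\<Sum>\<sigma>\<in>#A. adjacencies n \<sigma>) = (\<Sum>\<tau>\<in>#B. adjacencies n \<tau>)"
proof -
  obtain \<pi> :: "nat set \<Rightarrow> nat"
    where \<pi>: "inj_on \<pi> (pairs n)" "\<And>e. e \<in> pairs n \<Longrightarrow> prime (\<pi> e)"
    using prime_labelling[OF finite_pairs] by blast
  have "cpoly_eval (PT_map n (\<lambda>e. if e \<in> pairs n then 1 / of_nat (\<pi> e) ^ 1 else 0))
      (binomial_poly A B) = 0"
    using \<pi>(2) by (intro eval_zero_at_inverse_coordinates n van) (auto dest: prime_gt_0_nat)
  then have "(of_nat (\<Prod>e\<in>#(\<Sum>\<sigma>\<in>#A. adjacencies n \<sigma>). \<pi> e) :: complex)
      = of_nat (\<Prod>e\<in>#(\<Sum>\<tau>\<in>#B. adjacencies n \<tau>). \<pi> e)"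
    unfolding cpoly_eval_binomial_poly prod_PT_map_power[OF n A] prod_PT_map_power[OF n B]
    by simp
  then show ?thesis
    using prod_prime_labels_inj[OF \<pi> set_adjacencies[OF n A] set_adjacencies[OF n B]]
    by (simp only: of_nat_eq_iff)
qed


section \<open>Generators of the vanishing ideal\<close>

text \<open>Every ideal containing the binomials contains all polynomials that vanish on the image,
  whether homogeneous or not.\<close>

lemma vanishing_on_image_in_binomial_ideal:
  assumes n: "n \<ge> 2" and f: "f \<in> carrier (poly_ring (PT_perms n))"
    and van: "vanishes_on f (PT_image n)"
    and I: "ideal I (poly_ring (PT_perms n))"
    and bin: "\<And>A B. set_mset A \<subseteq> PT_perms n \<Longrightarrow> set_mset B \<subseteq> PT_perms n \<Longrightarrow>
      (\<Sum>\<sigma>\<in>#A. adjacencies n \<sigma>) = (\<Sum>\<tau>\<in>#B. adjacencies n \<tau>) \<Longrightarrow> binomial_poly A B \<in> I"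
  shows "f \<in> I"
proof -
  let ?K = "Poly_Mapping.keys f"
  let ?c = "Poly_Mapping.lookup f"
  let ?d = "\<lambda>A. \<Sum>\<sigma>\<in>#A. adjacencies n \<sigma>"
  \<comment> \<open>A representative of each adjacency class.\<close>
  define r where "r \<alpha> = (SOME R. set_mset R \<subseteq> PT_perms n \<and> ?d R = \<alpha>)" for \<alpha>
  have r: "set_mset (r (?d A)) \<subseteq> PT_perms n \<and> ?d (r (?d A)) = ?d A"
    if "set_mset A \<subseteq> PT_perms n" for A
    unfolding r_def by (rule someI[of _ A]) (use that in simp)
  have split: "Poly_Mapping.single m (?c m)
    = Poly_Mapping.single 0 (?c m) * binomial_poly (exp_mset m) (r (?d (exp_mset m)))
      + Poly_Mapping.single (mset_exp (r (?d (exp_mset m)))) (?c m)" for m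
    by (simp add: binomial_poly_alt right_diff_distrib mult_single)
  have "f = (\<Sum>m\<in>?K. Poly_Mapping.single m (?c m))"
    by (simp only: sum_single_keys)
  also have "\<dots> = (\<Sum>m\<in>?K. Poly_Mapping.single 0 (?c m)
        * binomial_poly (exp_mset m) (r (?d (exp_mset m))))
      + (\<Sum>m\<in>?K. Poly_Mapping.single (mset_exp (r (?d (exp_mset m)))) (?c m))"
    by (subst split) (rule sum.distrib)
  also have "(\<Sum>m\<in>?K. Poly_Mapping.single (mset_exp (r (?d (exp_mset m)))) (?c m))
    = (\<Sum>\<alpha>\<in>(\<lambda>m. ?d (exp_mset m)) ` ?K. \<Sum>m | m \<in> ?K \<and> ?d (exp_mset m) = \<alpha>.
        Poly_Mapping.single (mset_exp (r (?d (exp_mset m)))) (?c m))"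
    by (rule sum.image_gen) simp
  also have "\<dots> = (\<Sum>\<alpha>\<in>(\<lambda>m. ?d (exp_mset m)) ` ?K. Poly_Mapping.single (mset_exp (r \<alpha>))
        (\<Sum>m | m \<in> ?K \<and> ?d (exp_mset m) = \<alpha>. ?c m))"
    unfolding single_sum by (intro sum.cong) auto
  also have "\<dots> = 0"
    by (simp only: adjacency_class_coeffs_sum_zero[OF n f van] single_zero sum.neutral_const)
  finally have eq: "f = (\<Sum>m\<in>?K. Poly_Mapping.single 0 (?c m)
        * binomial_poly (exp_mset m) (r (?d (exp_mset m))))" by simp
  have "Poly_Mapping.single 0 (?c m) * binomial_poly (exp_mset m) (r (?d (exp_mset m))) \<in> I"
    if "m \<in> ?K" for m
  proof -
    have m: "set_mset (exp_mset m) \<subseteq> PT_perms n"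
      using f that by (auto simp: mem_poly_ring_iff)
    then have "binomial_poly (exp_mset m) (r (?d (exp_mset m))) \<in> I"
      using r[OF m] by (intro bin) auto
    moreover have "Poly_Mapping.single 0 (?c m) \<in> carrier (poly_ring (PT_perms n))"
      by (simp add: mem_poly_ring_iff)
    ultimately show ?thesis using ideal.I_l_closed[OF I] by fastforce
  qed
  then have "(\<Sum>m\<in>?K. Poly_Mapping.single 0 (?c m)
        * binomial_poly (exp_mset m) (r (?d (exp_mset m)))) \<in> I"
    by (rule ideal_sum_closed[OF I])
  then show ?thesis using eq by simp
qed

theorem proposition4p4:
  fixes n :: nat
  assumes "n \<ge> 4"
  shows "(\<forall>A B. set_mset A \<subseteq> PT_perms n \<and> set_mset B \<subseteq> PT_perms n \<longrightarrow>
            (vanishes_on (binomial_poly A B) (toric_PT_variety n) \<longleftrightarrow>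
             (\<Sum>\<sigma>\<in>#A. adjacencies n \<sigma>) = (\<Sum>\<tau>\<in>#B. adjacencies n \<tau>))) \<and>
         Idl\<^bsub>poly_ring (PT_perms n)\<^esub>
           {binomial_poly A B | A B.
              set_mset A \<subseteq> PT_perms n \<and> set_mset B \<subseteq> PT_perms n \<and>
              (\<Sum>\<sigma>\<in>#A. adjacencies n \<sigma>) = (\<Sum>\<tau>\<in>#B. adjacencies n \<tau>)}
         = vanishing_ideal (PT_perms n) (toric_PT_variety n)"
    (is "?binomials \<and> Idl\<^bsub>?R\<^esub> ?S = ?J")
proof
  have n: "n \<ge> 2" using assms by simp
  have on_image: "vanishes_on f (PT_image n)" if "vanishes_on f (toric_PT_variety n)" for f
    using that PT_image_subset_variety by (auto simp: vanishes_on_def)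
  show ?binomials
    using binomial_vanishes_on_variety[OF n] adjacencies_eq_if_binomial_vanishes[OF n _ _ on_image]
    by blast
  interpret R: cring ?R by (rule cring_poly_ring)
  have S: "?S \<subseteq> carrier ?R" using binomial_poly_carrier by blast
  show "Idl\<^bsub>?R\<^esub> ?S = ?J"
  proof
    show "Idl\<^bsub>?R\<^esub> ?S \<subseteq> ?J"
    proof (rule R.genideal_minimal[OF ideal_vanishing_ideal])
      show "?S \<subseteq> ?J"
        using binomial_vanishes_on_variety[OF n] binomial_poly_carrier
        by (auto simp: vanishing_ideal_def)
    qed
    show "?J \<subseteq> Idl\<^bsub>?R\<^esub> ?S"
    proof
      fix f assume "f \<in> ?J"
      then have "f \<in> carrier ?R" "vanishes_on f (PT_image n)"
        using on_image by (auto simp: vanishing_ideal_def)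
      then show "f \<in> Idl\<^bsub>?R\<^esub> ?S"
      proof (rule vanishing_on_image_in_binomial_ideal[OF n _ _ R.genideal_ideal[OF S]])
        fix A B
        assume "set_mset A \<subseteq> PT_perms n" "set_mset B \<subseteq> PT_perms n"
          "(\<Sum>\<sigma>\<in>#A. adjacencies n \<sigma>) = (\<Sum>\<tau>\<in>#B. adjacencies n \<tau>)"
        then have "binomial_poly A B \<in> ?S" by blast
        then show "binomial_poly A B \<in> Idl\<^bsub>?R\<^esub> ?S"
          by (rule subsetD[OF R.genideal_self[OF S]])
      qed
    qed
  qed
qed

end
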